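(* Let $G$ be a finite abelian group, let $f:G\to\mathbb{C}$, and let $K$ be any subfield of $\mathbb{C}$. Then $f(x)\in K$ for all $x\in G$ if and only if for every character $e\in\widehat G$, writing $M=|e|$ for the order of $e$ in $\widehat G$ and $L=K(\zeta_M)$, we have $\hat f(e)\in L$, and $\sigma_u(\hat f(e))=\hat f(e^u)$ for each $\sigma_u\in\mathrm{Gal}(L/K)$.
   Context: $\widehat G$ is the dual group of characters $G\to\mathbb{C}^\times$, written multiplicatively. The Fourier transform is $\hat f(e)=\sum_{x\in G}f(x)\overline{e(x)}$ for $e\in\widehat G$. $\zeta_M=e^{2\pi i/M}$ is a primitive $M$th root of unity. $\mathrm{Gal}(L/K)$ is embedded in $\mathbb{Z}_M^\times=(\mathbb{Z}/M\mathbb{Z})^\times$ by $\sigma_u\mapsto u$, where $\sigma_u$ is the automorphism with $\sigma_u(\zeta)=\zeta^u$ for all $M$th roots of unity $\zeta$. *)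

theory Defs
  imports Complex_Main "HOL-Algebra.Algebra"
begin

definition complex_ring :: "complex ring" where
  "complex_ring = \<lparr>carrier = UNIV, monoid.mult = (*), one = 1, ring.zero = 0, add = (+)\<rparr>"

text \<open>
  Characters are extensional homomorphisms into the unit group of the complex numbers, so that two
  characters are equal exactly when they agree on the carrier. Hence the integer power in the dual
  group, and \<open>group.ord\<close>, are the usual power and order of a character.
\<close>

definition dual_group :: "('a, 'b) monoid_scheme \<Rightarrow> ('a \<Rightarrow> complex) monoid" where
  "dual_group G =
    \<lparr>carrier = hom G (units_of complex_ring) \<inter> extensional (carrier G),
     monoid.mult = (\<lambda>e e'. \<lambda>x\<in>carrier G. e x * e' x),
     one = (\<lambda>x\<in>carrier G. 1)\<rparr>"

definition fourier :: "('a, 'b) monoid_scheme \<Rightarrow> ('a \<Rightarrow> complex) \<Rightarrow> ('a \<Rightarrow> complex) \<Rightarrow> complex" where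
  "fourier G f e = (\<Sum>x\<in>carrier G. f x * cnj (e x))"

definition zeta :: "nat \<Rightarrow> complex" where
  "zeta M = exp (2 * of_real pi * \<i> / of_nat M)"

definition adjoin :: "complex set \<Rightarrow> complex \<Rightarrow> complex set" where
  "adjoin K z = generate_field complex_ring (insert z K)"

definition Gal :: "complex set \<Rightarrow> complex set \<Rightarrow> (complex \<Rightarrow> complex) set" where
  "Gal L K =
    {\<sigma> \<in> Bij L. \<sigma> \<in> ring_hom (complex_ring\<lparr>carrier := L\<rparr>) (complex_ring\<lparr>carrier := L\<rparr>)
      \<and> (\<forall>x\<in>K. \<sigma> x = x)}"

text \<open>
  \<open>is_sigma M u \<sigma>\<close> says that \<open>\<sigma>\<close> is the automorphism \<open>\<sigma>\<^sub>u\<close>, where the residue class \<open>u\<close> in the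
  unit group modulo \<open>M\<close> is given by any integer representative.
\<close>

definition is_sigma :: "nat \<Rightarrow> int \<Rightarrow> (complex \<Rightarrow> complex) \<Rightarrow> bool" where
  "is_sigma M u \<sigma> \<longleftrightarrow> coprime u (int M) \<and> (\<forall>z. z ^ M = 1 \<longrightarrow> \<sigma> z = z powi u)"

lemma field_complex_ring: "field complex_ring"
proof -
  have "\<exists>y. x + y = 0" for x :: complex
    by (metis add.right_inverse)
  then have "cring complex_ring"
    by unfold_locales
      (auto simp: complex_ring_def Units_def algebra_simps)
  moreover have "Units complex_ring = UNIV - {0}"
    by (auto simp: complex_ring_def Units_def) (metis left_inverse mult.commute)
  ultimately show ?thesis
    by (intro cring.cring_fieldI) (auto simp: complex_ring_def)
qed

lemma carrier_units_complex: "carrier (units_of complex_ring) = UNIV - {0}"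
  using field.field_Units[OF field_complex_ring]
  by (simp add: units_of_def complex_ring_def)

lemma mult_units_complex: "monoid.mult (units_of complex_ring) = (*)"
  by (simp add: units_of_def complex_ring_def)

lemma comm_group_dual:
  assumes "comm_group G"
  shows "comm_group (dual_group G)"
proof -
  interpret comm_group G by fact
  show ?thesis
  proof (rule comm_groupI)
    fix e assume e: "e \<in> carrier (dual_group G)"
    let ?d = "\<lambda>x\<in>carrier G. inverse (e x)"
    have "?d \<in> carrier (dual_group G)"
      using e by (auto simp: dual_group_def hom_def carrier_units_complex mult_units_complex)
    moreover have "?d \<otimes>\<^bsub>dual_group G\<^esub> e = \<one>\<^bsub>dual_group G\<^esub>"
      using e by (auto simp: dual_group_def hom_def carrier_units_complex Pi_iff restrict_def
          intro!: left_inverse)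
    ultimately show "\<exists>y\<in>carrier (dual_group G). y \<otimes>\<^bsub>dual_group G\<^esub> e = \<one>\<^bsub>dual_group G\<^esub>"
      by blast
  next
    fix e assume "e \<in> carrier (dual_group G)"
    then show "\<one>\<^bsub>dual_group G\<^esub> \<otimes>\<^bsub>dual_group G\<^esub> e = e"
      by (auto simp: dual_group_def extensional_def)
  qed (auto simp: dual_group_def hom_def carrier_units_complex mult_units_complex Pi_iff
        mult_ac restrict_def extensional_def)
qed

end

theory Submission
  imports Defs "HOL-Computational_Algebra.Polynomial"
begin

text \<open>
  If \<open>f\<close> takes values in \<open>K\<close>, apply \<open>\<sigma>\<^sub>u\<close> termwise to the Fourier sum: it fixes \<open>f x\<close> and raises
  the root of unity \<open>cnj (e x)\<close> to the power \<open>u\<close>.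

  Conversely, let \<open>N\<close> be the order of the dual group. By Fourier inversion \<open>f x\<close> lies in
  \<open>K(\<zeta>\<^sub>N)\<close>. A \<open>K\<close>-homomorphism \<open>\<tau>\<close> on \<open>K(\<zeta>\<^sub>N)\<close> has the form
  \<open>\<zeta>\<^sub>N \<mapsto> \<zeta>\<^sub>N\<^sup>u\<close> with \<open>u\<close> coprime to \<open>N\<close>, and it restricts to \<open>\<sigma>\<^sub>u\<close> on each \<open>K(\<zeta>\<^sub>M)\<close> with
  \<open>M\<close> dividing \<open>N\<close>. Hence \<open>\<tau>\<close> only permutes the terms of the inversion formula, along \<open>e \<mapsto> e\<^sup>u\<close>, and
  fixes \<open>f x\<close>. An element of \<open>K(\<zeta>\<^sub>N)\<close> that is fixed by all such \<open>\<tau>\<close> lies in \<open>K\<close>.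
\<close>

section \<open>Subfields of the complex numbers\<close>

lemma complex_ring_simps [simp]:
  "carrier complex_ring = UNIV" "monoid.mult complex_ring = (*)" "monoid.one complex_ring = 1"
  "ring.zero complex_ring = 0" "add complex_ring = (+)"
  by (simp_all add: complex_ring_def)

lemma a_inv_complex_ring [simp]: "a_inv complex_ring x = - x"
proof -
  interpret R: field complex_ring by (rule field_complex_ring)
  show ?thesis using R.minus_equality[of "- x" x] by simp
qed

lemma m_inv_complex_ring: "x \<noteq> 0 \<Longrightarrow> m_inv complex_ring x = inverse x"
proof -
  interpret R: field complex_ring by (rule field_complex_ring)
  assume "x \<noteq> 0" then show ?thesis using R.inv_unique'[of x "inverse x"] by simp
qed

locale complex_subfield =
  fixes K :: "complex set"
  assumes subfield: "subfield K complex_ring"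
begin

lemma one_mem [simp]: "1 \<in> K"
  using subringE(3)[OF subfieldE(1)[OF subfield]] by simp

lemma zero_mem [simp]: "0 \<in> K"
  using subringE(2)[OF subfieldE(1)[OF subfield]] by simp

lemma uminus_mem: "a \<in> K \<Longrightarrow> - a \<in> K"
  using subringE(5)[OF subfieldE(1)[OF subfield]] by simp

lemma mult_mem: "a \<in> K \<Longrightarrow> b \<in> K \<Longrightarrow> a * b \<in> K"
  using subringE(6)[OF subfieldE(1)[OF subfield]] by simp

lemma add_mem: "a \<in> K \<Longrightarrow> b \<in> K \<Longrightarrow> a + b \<in> K"
  using subringE(7)[OF subfieldE(1)[OF subfield]] by simp

lemma diff_mem: "a \<in> K \<Longrightarrow> b \<in> K \<Longrightarrow> a - b \<in> K"
  using add_mem[of a "- b"] uminus_mem by simp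

lemma inverse_mem: "a \<in> K \<Longrightarrow> inverse a \<in> K"
proof -
  interpret R: field complex_ring by (rule field_complex_ring)
  assume "a \<in> K" then show ?thesis
    using R.subfield_m_inv(1)[OF subfield, of a] m_inv_complex_ring[of a] by (cases "a = 0") auto
qed

lemma divide_mem: "a \<in> K \<Longrightarrow> b \<in> K \<Longrightarrow> a / b \<in> K"
  by (simp add: divide_inverse mult_mem inverse_mem)

lemma power_mem: "a \<in> K \<Longrightarrow> a ^ n \<in> K"
  by (induction n) (auto simp: mult_mem)

lemma of_nat_mem: "of_nat n \<in> K"
  by (induction n) (auto simp: add_mem)

lemma sum_mem: "(\<And>i. i \<in> I \<Longrightarrow> g i \<in> K) \<Longrightarrow> sum g I \<in> K"
  by (induction I rule: infinite_finite_induct) (auto simp: add_mem)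

lemmas mem_intros = uminus_mem mult_mem add_mem diff_mem inverse_mem divide_mem power_mem of_nat_mem sum_mem

lemma subset_adjoin: "K \<subseteq> adjoin K z"
  by (auto simp: adjoin_def intro: generate_field.incl)

lemma adjoin_subset: "z \<in> L \<Longrightarrow> K \<subseteq> L \<Longrightarrow> complex_subfield L \<Longrightarrow> adjoin K z \<subseteq> L"
  unfolding adjoin_def using field.generate_field_min_subfield1[OF field_complex_ring]
  by (simp add: complex_subfield_def)

end

lemma complex_subfield_adjoin: "complex_subfield (adjoin K z)"
  unfolding adjoin_def complex_subfield_def
  by (rule field.generate_field_is_subfield[OF field_complex_ring]) simp

lemma mem_adjoin: "z \<in> adjoin K z"
  by (auto simp: adjoin_def intro: generate_field.incl)

text \<open>The unit has its own rule in \<open>generate_field\<close>; the premise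
  \<open>1 \<in> K\<close> absorbs it into the case \<open>base\<close>.\<close>

lemma adjoin_induct [consumes 2, case_names base gen uminus inverse add mult]:
  assumes "a \<in> adjoin K z" and "1 \<in> K"
    and "\<And>a. a \<in> K \<Longrightarrow> P a" and "P z"
    and "\<And>a. P a \<Longrightarrow> P (- a)" and "\<And>a. a \<noteq> 0 \<Longrightarrow> P a \<Longrightarrow> P (inverse a)"
    and "\<And>a b. P a \<Longrightarrow> P b \<Longrightarrow> P (a + b)" and "\<And>a b. P a \<Longrightarrow> P b \<Longrightarrow> P (a * b)"
  shows "P a"
  using assms(1) unfolding adjoin_def
  by (induction rule: generate_field.induct) (use assms(2-) in \<open>auto simp: m_inv_complex_ring\<close>)

section \<open>Homomorphisms over a subfield\<close>

text \<open>Neither values in \<open>L\<close> nor injectivity is demanded, and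
  \<open>\<sigma>\<close> is arbitrary outside \<open>L\<close>, so evaluation at another conjugate
  fits directly. Fixing \<open>K\<close> already gives the values at 0, 1 and -1.\<close>

locale relative_hom = K: complex_subfield K + L: complex_subfield L for K L +
  fixes \<sigma> :: "complex \<Rightarrow> complex"
  assumes K_subset_L: "K \<subseteq> L"
    and fixed: "a \<in> K \<Longrightarrow> \<sigma> a = a"
    and hom_add: "a \<in> L \<Longrightarrow> b \<in> L \<Longrightarrow> \<sigma> (a + b) = \<sigma> a + \<sigma> b"
    and hom_mult: "a \<in> L \<Longrightarrow> b \<in> L \<Longrightarrow> \<sigma> (a * b) = \<sigma> a * \<sigma> b"
begin

lemma hom_uminus: "a \<in> L \<Longrightarrow> \<sigma> (- a) = - \<sigma> a"
  using hom_mult[of "-1" a] fixed[of "-1"] by (simp add: K.uminus_mem L.uminus_mem)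

lemma hom_inverse: "a \<in> L \<Longrightarrow> \<sigma> (inverse a) = inverse (\<sigma> a)"
  using hom_mult[of a "inverse a"] fixed[of 0] fixed[of 1]
  by (cases "a = 0") (auto simp: L.inverse_mem intro: inverse_unique[symmetric])

lemma hom_power: "a \<in> L \<Longrightarrow> \<sigma> (a ^ n) = \<sigma> a ^ n"
  by (induction n) (auto simp: hom_mult L.power_mem fixed)

lemma hom_sum: "(\<And>i. i \<in> I \<Longrightarrow> g i \<in> L) \<Longrightarrow> \<sigma> (sum g I) = (\<Sum>i\<in>I. \<sigma> (g i))"
  by (induction I rule: infinite_finite_induct) (auto simp: hom_add L.sum_mem fixed)

text \<open>The kernel is trivial: if a - 1 were a nonzero element of it, multiplying by its inverse
  would send 1 to 0. Injectivity and preservation of the order of a root of unity both come from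
  this.\<close>

lemma hom_eq_1_iff: assumes "a \<in> L" shows "\<sigma> a = 1 \<longleftrightarrow> a = 1"
proof
  assume *: "\<sigma> a = 1"
  have "a - 1 \<in> L" using assms by (simp add: L.diff_mem)
  moreover have "\<sigma> (a - 1) = 0"
    using hom_add[of a "-1"] assms * fixed[of "-1"] by (simp add: L.uminus_mem K.uminus_mem)
  ultimately have "\<sigma> ((a - 1) * inverse (a - 1)) = 0"
    by (simp add: hom_mult L.inverse_mem)
  then show "a = 1" using fixed[of 1] by (cases "a = 1") auto
qed (simp add: fixed)

lemma relative_hom_mono:
  "complex_subfield F \<Longrightarrow> K \<subseteq> F \<Longrightarrow> F \<subseteq> L \<Longrightarrow> relative_hom K F \<sigma>"
  by (auto simp: relative_hom_def relative_hom_axioms_def K.complex_subfield_axioms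
        fixed hom_add hom_mult subset_iff)

end

lemma Gal_relative_hom:
  assumes "complex_subfield K" "complex_subfield L" "K \<subseteq> L" "\<sigma> \<in> Gal L K"
  shows "relative_hom K L \<sigma>"
  using assms
  by (auto simp: relative_hom_def relative_hom_axioms_def Gal_def ring_hom_def)

text \<open>The field is generated by \<open>z\<close> over \<open>K\<close>, so stability under
  \<open>\<sigma>\<close> and surjectivity both propagate from this single generator. The
  restriction makes the map extensional, as \<open>Bij\<close> requires.\<close>

lemma relative_hom_restrict_Gal:
  assumes "relative_hom K (adjoin K z) \<sigma>" and "\<sigma> z \<in> adjoin K z" and "z \<in> \<sigma> ` adjoin K z"
  shows "restrict \<sigma> (adjoin K z) \<in> Gal (adjoin K z) K"
proof -
  let ?L = "adjoin K z"
  interpret relative_hom K ?L \<sigma> by fact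
  have into: "\<sigma> a \<in> ?L" if "a \<in> ?L" for a
  proof -
    have "a \<in> ?L \<and> \<sigma> a \<in> ?L"
      using that K.one_mem
    proof (induction rule: adjoin_induct)
      case (base a) then show ?case using K_subset_L by (auto simp: fixed)
    qed (auto simp: assms mem_adjoin hom_uminus hom_inverse hom_add hom_mult L.mem_intros)
    then show ?thesis by simp
  qed
  have onto: "a \<in> \<sigma> ` ?L" if "a \<in> ?L" for a
    using that K.one_mem
  proof (induction rule: adjoin_induct)
    case (base a) then show ?case using K_subset_L fixed by (metis imageI subsetD)
  next
    case (uminus a) then show ?case by (auto simp: hom_uminus[symmetric] L.uminus_mem)
  next
    case (inverse a) then show ?case by (auto simp: hom_inverse[symmetric] L.inverse_mem)
  next
    case (add a b) then show ?case by (auto simp: hom_add[symmetric] L.add_mem)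
  next
    case (mult a b) then show ?case by (auto simp: hom_mult[symmetric] L.mult_mem)
  qed (use assms in auto)
  have inj: "inj_on \<sigma> ?L"
  proof (rule inj_onI)
    fix a b assume ab: "a \<in> ?L" "b \<in> ?L" "\<sigma> a = \<sigma> b"
    \<comment> \<open>The shift by 1 turns injectivity into a case of
      \<open>hom_eq_1_iff\<close>.\<close>
    have "a - b + 1 \<in> ?L" using ab by (simp add: L.mem_intros)
    moreover have "\<sigma> (a - b + 1) = 1"
      using hom_add[of a "- b + 1"] hom_add[of "- b" 1] ab
      by (simp add: hom_uminus L.mem_intros fixed algebra_simps)
    ultimately show "a = b" using hom_eq_1_iff by fastforce
  qed
  have "bij_betw \<sigma> ?L ?L"
    using into onto inj by (auto simp: bij_betw_def)
  then have "bij_betw (restrict \<sigma> ?L) ?L ?L"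
    by (simp cong: bij_betw_cong)
  then show ?thesis
    using K_subset_L into
    by (auto simp: Gal_def Bij_def ring_hom_def hom_add hom_mult L.mem_intros fixed subset_iff)
qed

section \<open>Roots of unity\<close>

lemma zeta_power: "zeta n ^ k = cis (2 * pi * real k / real n)"
  by (simp add: zeta_def cis_conv_exp exp_of_nat_mult[symmetric] mult_ac)

lemma zeta_power_self: "n > 0 \<Longrightarrow> zeta n ^ n = 1"
  by (simp add: zeta_power)

lemma root_of_unity_zeta_power:
  assumes "n > 0" "z ^ n = 1"
  obtains k where "z = zeta n ^ k"
  using bij_betw_roots_unity[OF assms(1)] assms(2)
  by (auto simp: bij_betw_def zeta_power[symmetric] set_eq_iff image_iff)

text \<open>Reduce the exponent modulo \<open>n\<close>; exponents below \<open>n\<close> give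
  distinct powers, so among them only 0 gives 1.\<close>

lemma zeta_power_eq_1_iff:
  assumes "n > 0"
  shows "zeta n ^ k = 1 \<longleftrightarrow> n dvd k"
proof -
  have "zeta n ^ k = (zeta n ^ n) ^ (k div n) * zeta n ^ (k mod n)"
    by (metis mult_div_mod_eq power_add power_mult)
  then have "zeta n ^ k = zeta n ^ (k mod n)"
    using assms by (simp add: zeta_power_self)
  moreover have "zeta n ^ (k mod n) = zeta n ^ 0 \<longleftrightarrow> k mod n = 0"
    using bij_betw_roots_unity[OF assms] assms unfolding bij_betw_def zeta_power[symmetric]
    by (intro inj_on_eq_iff[of "\<lambda>k. zeta n ^ k" "{..<n}"]) auto
  ultimately show ?thesis by auto
qed

lemma zeta_dvd_power:
  assumes "m dvd n" "n > 0"
  shows "zeta m = zeta n ^ (n div m)"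
proof -
  have "zeta n ^ (n div m) = zeta m ^ 1"
    using assms by (subst (1 2) zeta_power) (auto elim!: dvdE)
  then show ?thesis by simp
qed

lemma root_of_unity_mem_adjoin:
  assumes "n > 0" "z ^ n = 1"
  shows "z \<in> adjoin K (zeta n)"
  using root_of_unity_zeta_power[OF assms] mem_adjoin complex_subfield.power_mem[OF complex_subfield_adjoin]
  by metis

text \<open>\<open>v\<close> is an inverse of \<open>u\<close> modulo \<open>n\<close>, from Bezout.
  For \<open>u = 0\<close> coprimality forces \<open>n = 1\<close>, so \<open>z\<close> is
  1.\<close>

lemma coprime_power_cancel:
  assumes "n > 0" "coprime u n"
  obtains v where "\<And>z::complex. z ^ n = 1 \<Longrightarrow> (z ^ u) ^ v = z"
proof (cases "u = 0")
  case True
  with assms have "n = 1" by simp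
  then show ?thesis using that[of 0] by simp
next
  case False
  then obtain x y where "u * x = n * y + gcd u n" using bezout_nat by blast
  then have "(z ^ u) ^ x = z" if "z ^ n = 1" for z :: complex
    using assms that by (simp add: power_mult[symmetric] power_add) (simp add: power_mult)
  then show ?thesis by (rule that)
qed

text \<open>The image of \<open>zeta n\<close> is again an \<open>n\<close>-th root of unity. The
  exponent is coprime to \<open>n\<close> because an injective homomorphism cannot lower the
  order.\<close>

lemma zeta_conjugate:
  assumes K: "complex_subfield K" and "n > 0"
    and hom: "relative_hom K (adjoin K (zeta n)) \<sigma>"
  obtains u where "coprime u n" "\<sigma> (zeta n) = zeta n ^ u"
proof -
  interpret relative_hom K "adjoin K (zeta n)" \<sigma> by fact
  have "\<sigma> (zeta n) ^ n = 1"
    using mem_adjoin assms(2) by (simp add: hom_power[symmetric] zeta_power_self fixed)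
  then obtain u where u: "\<sigma> (zeta n) = zeta n ^ u"
    using root_of_unity_zeta_power assms(2) by blast
  \<comment> \<open>The \<open>m\<close>-th power of the image is 1, hence so is that of
    \<open>zeta n\<close>; then \<open>n\<close> divides \<open>m\<close>, which leaves only gcd
    1.\<close>
  define m where "m = n div gcd u n"
  have "n dvd u * m"
    unfolding m_def by (metis div_mult_swap dvd_div_mult dvd_triv_right gcd_dvd1 gcd_dvd2)
  then have "\<sigma> (zeta n ^ m) = 1"
    using u mem_adjoin by (simp add: hom_power power_mult[symmetric] zeta_power_eq_1_iff assms)
  then have "n dvd m"
    using mem_adjoin hom_eq_1_iff L.power_mem zeta_power_eq_1_iff assms(2) by blast
  moreover have "n = m * gcd u n" by (simp add: m_def)
  ultimately have "gcd u n = 1" using assms(2)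
    by (metis dvd_mult_cancel1 mult.commute nat_0_less_mult_iff dvd_triv_left)
  then show ?thesis using that u by (simp add: coprime_iff_gcd_eq_1)
qed

section \<open>The fixed field of the Galois group of a cyclotomic extension\<close>

context complex_subfield
begin

text \<open>\<open>K\<close> is a set, not a type, so the ring K[X] is taken as a set of complex
  polynomials.\<close>

definition polys :: "complex poly set" where
  "polys = {p. \<forall>i. coeff p i \<in> K}"

lemma zero_polys [simp]: "0 \<in> polys"
  by (simp add: polys_def)

lemma add_polys: "p \<in> polys \<Longrightarrow> q \<in> polys \<Longrightarrow> p + q \<in> polys"
  by (simp add: polys_def add_mem)

lemma uminus_polys: "p \<in> polys \<Longrightarrow> - p \<in> polys"
  by (simp add: polys_def uminus_mem)

lemma diff_polys: "p \<in> polys \<Longrightarrow> q \<in> polys \<Longrightarrow> p - q \<in> polys"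
  by (simp add: polys_def diff_mem)

lemma mult_polys: "p \<in> polys \<Longrightarrow> q \<in> polys \<Longrightarrow> p * q \<in> polys"
  by (simp add: polys_def coeff_mult mult_mem sum_mem)

lemma monom_polys: "c \<in> K \<Longrightarrow> monom c n \<in> polys"
  by (simp add: polys_def)

lemma const_polys: "c \<in> K \<Longrightarrow> [:c:] \<in> polys"
  using monom_polys[of c 0] by (simp add: monom_0)

lemmas polys_intros = add_polys uminus_polys diff_polys mult_polys monom_polys const_polys

section \<open>Division with remainder and minimal polynomials over \<open>K\<close>\<close>

text \<open>Long division: subtracting a monomial multiple of \<open>p\<close> cancels the leading
  term of \<open>q\<close>, and the quotient of the two leading coefficients stays in
  \<open>K\<close>.\<close>

lemma polys_divide:
  assumes "p \<in> polys" "p \<noteq> 0" "q \<in> polys"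
  obtains s r where "s \<in> polys" "r \<in> polys" "q = p * s + r" "r = 0 \<or> degree r < degree p"
proof -
  have "\<exists>s\<in>polys. \<exists>r\<in>polys. q = p * s + r \<and> (r = 0 \<or> degree r < degree p)"
    using assms(3)
  \<comment> \<open>The length of the coefficient list, unlike the degree, also drops when a nonzero
    constant becomes 0.\<close>
  proof (induction "length (coeffs q)" arbitrary: q rule: less_induct)
    case less
    show ?case
    proof (cases "q = 0 \<or> degree q < degree p")
      case True
      then show ?thesis using less.prems by (intro bexI[of _ 0] bexI[of _ q]) auto
    next
      case False
      define m where "m = monom (lead_coeff q / lead_coeff p) (degree q - degree p)"
      define q' where "q' = q - p * m"
      have m: "m \<in> polys"
        using assms less.prems unfolding m_def by (intro monom_polys divide_mem) (auto simp: polys_def)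
      have q': "q' \<in> polys"
        using m assms less.prems by (simp add: q'_def polys_intros)
      have "degree (p * m) \<le> degree q"
        using degree_mult_le[of p m] degree_monom_le[of "lead_coeff q / lead_coeff p" "degree q - degree p"] False
        unfolding m_def by linarith
      then have "degree q' \<le> degree q"
        by (simp add: q'_def degree_diff_le)
      moreover have "coeff q' (degree q) = 0"
        using False assms(2) coeff_mult_degree_sum[of p m]
        by (auto simp: q'_def m_def degree_monom_eq)
      ultimately have "q' = 0 \<or> degree q' < degree q"
        by (rule eq_zero_or_degree_less)
      then have "length (coeffs q') < length (coeffs q)"
        using False by (cases "q' = 0") (auto simp: length_coeffs_degree)
      from less.hyps[OF this q'] obtain s r where
        sr: "s \<in> polys" "r \<in> polys" "q' = p * s + r" "r = 0 \<or> degree r < degree p" by blast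
      then have "q = p * (s + m) + r"
        by (simp add: q'_def algebra_simps)
      then show ?thesis using sr m add_polys by blast
    qed
  qed
  then show ?thesis using that by blast
qed

text \<open>A generator of the ideal of polynomials over \<open>K\<close> that vanish at
  \<open>z\<close>. It is not normalised to be monic.\<close>

definition is_min_poly :: "complex poly \<Rightarrow> complex \<Rightarrow> bool" where
  "is_min_poly p z \<longleftrightarrow> p \<in> polys \<and> p \<noteq> 0 \<and> poly p z = 0 \<and>
    (\<forall>q\<in>polys. poly q z = 0 \<longrightarrow> (\<exists>s\<in>polys. q = p * s))"

lemma is_min_polyD:
  assumes "is_min_poly p z"
  shows "p \<in> polys" "p \<noteq> 0" "poly p z = 0"
    and "q \<in> polys \<Longrightarrow> poly q z = 0 \<Longrightarrow> \<exists>s\<in>polys. q = p * s"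
  using assms by (auto simp: is_min_poly_def)

text \<open>A nonzero vanishing polynomial of least degree works: remainders modulo it also vanish
  at \<open>z\<close>, so they must be 0.\<close>

lemma min_poly_exists:
  assumes "q \<in> polys" "q \<noteq> 0" "poly q z = 0"
  obtains p where "is_min_poly p z"
proof -
  let ?P = "\<lambda>p. p \<in> polys \<and> p \<noteq> 0 \<and> poly p z = 0"
  have "?P q" using assms by simp
  then obtain p where p: "?P p" and min: "\<And>r. ?P r \<Longrightarrow> degree p \<le> degree r"
    using ex_has_least_nat[of ?P q degree] by blast
  have "\<exists>s\<in>polys. r = p * s" if r: "r \<in> polys" "poly r z = 0" for r
  proof -
    obtain s t where st: "s \<in> polys" "t \<in> polys" "r = p * s + t" "t = 0 \<or> degree t < degree p"
      using polys_divide p r(1) by blast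
    then have "poly t z = 0" using p r(2) by simp
    then have "t = 0" using st min[of t] by (meson not_le)
    then show ?thesis using st by auto
  qed
  then show ?thesis using that p unfolding is_min_poly_def by blast
qed

text \<open>This is irreducibility: the other factor vanishes at \<open>z\<close>, so it is a
  multiple of \<open>p\<close>, and cancelling \<open>p\<close> shows that \<open>s\<close> is a
  unit.\<close>

lemma min_poly_factor:
  assumes "is_min_poly p z" "p = s * t" "s \<in> polys" "t \<in> polys" "poly s z \<noteq> 0"
  shows "\<exists>u\<in>polys. s * u = 1"
proof -
  have "poly t z = 0" using is_min_polyD(3)[OF assms(1)] assms by auto
  then obtain u where u: "u \<in> polys" "t = p * u" using is_min_polyD(4)[OF assms(1)] assms(4) by blast
  then have "p * (s * u) = p * 1" using assms(2) by (metis mult.assoc mult.commute mult_1_right)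
  then show ?thesis using u is_min_polyD(2)[OF assms(1)] by auto
qed

lemma poly_reduce:
  assumes p: "is_min_poly p z" and q: "q \<in> polys"
  obtains r where "r \<in> polys" "poly r z = poly q z" "r = 0 \<or> degree r < degree p"
proof -
  obtain s r where "s \<in> polys" "r \<in> polys" "q = p * s + r" "r = 0 \<or> degree r < degree p"
    using polys_divide is_min_polyD[OF p] q by blast
  then show ?thesis using that[of r] is_min_polyD(3)[OF p] by simp
qed

text \<open>Evaluating p = q t + r at \<open>z\<close> gives q(z) t(z) = -r(z), so an inverse for
  the value of \<open>r\<close>, which has lower degree, yields one for that of \<open>q\<close>.
  The descent ends when \<open>q\<close> divides \<open>p\<close> and is therefore a unit.\<close>

lemma poly_inverse:
  assumes p: "is_min_poly p z" and q: "q \<in> polys" "poly q z \<noteq> 0"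
  shows "\<exists>s\<in>polys. poly q z * poly s z = 1"
proof -
  have small: "\<exists>s\<in>polys. poly q z * poly s z = 1"
    if "q \<in> polys" "q \<noteq> 0" "degree q < degree p" for q
    using that
  proof (induction "degree q" arbitrary: q rule: less_induct)
    case less
    obtain t r where tr: "t \<in> polys" "r \<in> polys" "p = q * t + r" "r = 0 \<or> degree r < degree q"
      using polys_divide is_min_polyD(1)[OF p] less.prems by blast
    have nz: "poly q z \<noteq> 0"
    proof
      assume "poly q z = 0"
      then obtain s where "q = p * s" using is_min_polyD(4)[OF p] less.prems by blast
      then show False using less.prems by (auto simp: degree_mult_eq)
    qed
    show ?case
    proof (cases "r = 0")
      case True
      then obtain u where u: "u \<in> polys" "q * u = 1"
        using min_poly_factor[OF p] tr less.prems nz by auto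
      then have "poly q z * poly u z = 1" by (metis poly_mult poly_1)
      then show ?thesis using u(1) by blast
    next
      case False
      then obtain s where s: "s \<in> polys" "poly r z * poly s z = 1"
        using less.hyps[of r] tr less.prems by auto
      have "poly q z * poly t z = - poly r z"
        using tr(3) is_min_polyD(3)[OF p] by (metis add_eq_0_iff2 poly_add poly_mult)
      then have "poly q z * poly (- t * s) z = 1"
        using s by (simp add: mult.assoc[symmetric])
      moreover have "- t * s \<in> polys"
        using s tr by (simp only: polys_intros)
      ultimately show ?thesis by blast
    qed
  qed
  \<comment> \<open>Reduction modulo \<open>p\<close> keeps the value at \<open>z\<close> and brings
    the degree below that of \<open>p\<close>.\<close>
  obtain r where r: "r \<in> polys" "poly r z = poly q z" "r = 0 \<or> degree r < degree p"
    using poly_reduce[OF p q(1)] by blast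
  then have "r \<noteq> 0" using q by auto
  then show ?thesis using small[of r] r by simp
qed

text \<open>For algebraic \<open>z\<close> the ring K[z] is already a field; closure under inverses
  is \<open>poly_inverse\<close>.\<close>

lemma adjoin_eq_poly_image:
  assumes p: "is_min_poly p z"
  shows "adjoin K z = (\<lambda>q. poly q z) ` polys"
proof (intro Set.equalityI subsetI)
  fix a assume "a \<in> adjoin K z"
  then show "a \<in> (\<lambda>q. poly q z) ` polys"
    using one_mem
  proof (induction rule: adjoin_induct)
    case (base a)
    then show ?case using const_polys[of a] by (intro rev_image_eqI[of "[:a:]"]) auto
  next
    case gen
    show ?case using monom_polys[of 1 1] by (intro rev_image_eqI[of "monom 1 1"]) (auto simp: poly_monom)
  next
    case (inverse a)
    then obtain q where q: "q \<in> polys" "a = poly q z" by blast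
    with inverse obtain s where "s \<in> polys" "a * poly s z = 1" using poly_inverse[OF p] by blast
    then show ?case using inverse_unique by (metis imageI)
  qed (auto simp: image_iff simp flip: poly_minus poly_add poly_mult intro: polys_intros)
next
  interpret L: complex_subfield "adjoin K z" by (rule complex_subfield_adjoin)
  fix a assume "a \<in> (\<lambda>q. poly q z) ` polys"
  then show "a \<in> adjoin K z"
    using subset_adjoin mem_adjoin by (force simp: polys_def poly_altdef intro!: L.mem_intros)
qed

section \<open>Conjugates and the counting of roots\<close>

text \<open>Replacing \<open>z\<close> by \<open>w\<close> in a polynomial expression is well
  defined: two polynomials that agree at \<open>z\<close> differ by a multiple of \<open>p\<close>,
  which vanishes at \<open>w\<close>.\<close>

lemma conjugate_hom:
  assumes p: "is_min_poly p z" and w: "poly p w = 0"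
  obtains \<tau> where "relative_hom K (adjoin K z) \<tau>" "\<And>q. q \<in> polys \<Longrightarrow> \<tau> (poly q z) = poly q w"
proof -
  define \<tau> where "\<tau> a = poly (SOME q. q \<in> polys \<and> poly q z = a) w" for a
  have \<tau>: "\<tau> (poly q z) = poly q w" if q: "q \<in> polys" for q
  proof -
    define r where "r = (SOME r. r \<in> polys \<and> poly r z = poly q z)"
    have "r \<in> polys \<and> poly r z = poly q z"
      unfolding r_def by (rule someI[of _ q]) (use q in simp)
    then obtain s where "r - q = p * s"
      using is_min_polyD(4)[OF p, of "r - q"] q diff_polys by auto
    then have "poly r w - poly q w = 0" using w by (metis mult_zero_left poly_diff poly_mult)
    then show ?thesis by (simp add: \<tau>_def r_def)
  qed
  have "relative_hom K (adjoin K z) \<tau>"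
  proof (intro relative_hom.intro relative_hom_axioms.intro)
    show "\<tau> a = a" if "a \<in> K" for a
      using \<tau>[OF const_polys[OF that]] by simp
    show "\<tau> (a + b) = \<tau> a + \<tau> b" if ab: "a \<in> adjoin K z" "b \<in> adjoin K z" for a b
    proof -
      obtain q r where "q \<in> polys" "a = poly q z" "r \<in> polys" "b = poly r z"
        using ab unfolding adjoin_eq_poly_image[OF p] by blast
      then show ?thesis using \<tau>[of "q + r"] by (simp add: \<tau> polys_intros)
    qed
    show "\<tau> (a * b) = \<tau> a * \<tau> b" if ab: "a \<in> adjoin K z" "b \<in> adjoin K z" for a b
    proof -
      obtain q r where "q \<in> polys" "a = poly q z" "r \<in> polys" "b = poly r z"
        using ab unfolding adjoin_eq_poly_image[OF p] by blast
      then show ?thesis using \<tau>[of "q * r"] by (simp add: \<tau> polys_intros)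
    qed
  qed (auto simp: complex_subfield_axioms complex_subfield_adjoin subset_adjoin[THEN subsetD])
  then show ?thesis using that \<tau> by blast
qed

text \<open>Separability by counting: the roots of \<open>p\<close> and \<open>s\<close> together
  are the \<open>n\<close> distinct roots of unity, neither factor has more roots than its degree,
  and the degrees add up to \<open>n\<close>.\<close>

lemma card_roots_factor_of_root_of_unity_poly:
  fixes p s :: "complex poly"
  assumes "p * s = monom 1 n - 1" "n > 0"
  shows "card {w. poly p w = 0} = degree p"
proof -
  let ?q = "monom 1 n - 1 :: complex poly"
  have deg: "degree ?q = n"
    using assms(2) degree_add_eq_left[of "- 1" "monom 1 n :: complex poly"] by (simp add: degree_monom_eq)
  then have nz: "p \<noteq> 0" "s \<noteq> 0" using assms by auto
  have "{w. poly p w = 0} \<union> {w. poly s w = 0} = {w. poly ?q w = 0}"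
    unfolding assms(1)[symmetric] by auto
  also have "\<dots> = {w. w ^ n = 1}" by (simp add: poly_monom)
  finally have "n \<le> card {w. poly p w = 0} + card {w. poly s w = 0}"
    using card_roots_unity_eq[OF assms(2)] by (metis card_Un_le)
  moreover have "card {w. poly p w = 0} \<le> degree p" "card {w. poly s w = 0} \<le> degree s"
    using nz card_poly_roots_bound by blast+
  moreover have "degree p + degree s = n"
    using nz deg assms(1) degree_mult_eq by metis
  ultimately show ?thesis by linarith
qed

text \<open>
  Write \<open>a = r(\<zeta>)\<close> with \<open>r\<close> of smaller degree than the minimal polynomial \<open>p\<close> of \<open>\<zeta>\<close>.
  The polynomial \<open>r - a\<close> vanishes at all \<open>degree p\<close> conjugates of \<open>\<zeta>\<close>, so \<open>r\<close> is constant.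
\<close>

lemma fixed_by_conjugates_imp_mem:
  assumes n: "n > 0" and a: "a \<in> adjoin K (zeta n)"
    and fixed: "\<And>\<tau>. relative_hom K (adjoin K (zeta n)) \<tau> \<Longrightarrow> \<tau> a = a"
  shows "a \<in> K"
proof -
  let ?z = "zeta n" and ?q = "monom 1 n - 1 :: complex poly"
  have q: "?q \<in> polys" "poly ?q ?z = 0"
    using n monom_polys[of 1 n] const_polys[of 1] diff_polys
    by (auto simp: poly_monom zeta_power_self one_pCons)
  have "coeff ?q n \<noteq> 0" using n by simp
  then have "?q \<noteq> 0" by (metis coeff_0)
  then obtain p where p: "is_min_poly p ?z" using min_poly_exists q by blast
  obtain s where s: "?q = p * s" using is_min_polyD(4)[OF p] q by blast
  obtain q' where "q' \<in> polys" "a = poly q' ?z" using a unfolding adjoin_eq_poly_image[OF p] by blast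
  then obtain r where r: "r \<in> polys" "a = poly r ?z" "r = 0 \<or> degree r < degree p"
    using poly_reduce[OF p] by metis
  show ?thesis
  proof (cases "r = 0")
    case True
    then show ?thesis using r by simp
  next
    case False
    have roots: "poly r w = a" if "poly p w = 0" for w
    proof -
      obtain \<tau> where "relative_hom K (adjoin K ?z) \<tau>" "\<tau> (poly r ?z) = poly r w"
        using conjugate_hom[OF p \<open>poly p w = 0\<close>] r(1) by metis
      then show ?thesis using fixed r(2) by metis
    qed
    have "r - [:a:] = 0"
    proof (rule ccontr)
      assume nz: "r - [:a:] \<noteq> 0"
      have "degree p = card {w. poly p w = 0}"
        using card_roots_factor_of_root_of_unity_poly[OF s[symmetric] n] by simp
      also have "\<dots> \<le> card {w. poly (r - [:a:]) w = 0}"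
        using roots poly_roots_finite[OF nz] by (intro card_mono) auto
      also have "\<dots> \<le> degree (r - [:a:])"
        using nz by (rule card_poly_roots_bound)
      also have "\<dots> \<le> degree r"
        by (simp add: degree_diff_le)
      finally show False using False r by simp
    qed
    then have "coeff r 0 = a" by simp
    then show ?thesis using r(1) unfolding polys_def by (metis mem_Collect_eq)
  qed
qed

end

section \<open>Characters and Fourier inversion\<close>

context comm_group
begin

text \<open>Values outside \<open>H\<close> are free, which suits extension from one subgroup to a
  larger one. On a subgroup the value 1 at the unit forces nonvanishing.\<close>

definition character_on :: "'a set \<Rightarrow> ('a \<Rightarrow> complex) \<Rightarrow> bool" where
  "character_on H \<chi> \<longleftrightarrow> \<chi> \<one> = 1 \<and> (\<forall>x\<in>H. \<forall>y\<in>H. \<chi> (x \<otimes> y) = \<chi> x * \<chi> y)"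

lemma character_on_inv:
  assumes "subgroup H G" "character_on H \<chi>" "x \<in> H"
  shows "\<chi> (inv x) = inverse (\<chi> x)"
proof -
  interpret H: subgroup H G by fact
  have "\<chi> x * \<chi> (inv x) = 1"
    using assms by (metis H.m_inv_closed H.mem_carrier character_on_def r_inv)
  then show ?thesis by (metis inverse_unique)
qed

lemma character_on_nat_pow:
  assumes "subgroup H G" "character_on H \<chi>" "x \<in> H"
  shows "\<chi> (x [^] (n::nat)) = \<chi> x ^ n"
proof -
  interpret H: subgroup H G by fact
  have "x [^] n \<in> H \<and> \<chi> (x [^] n) = \<chi> x ^ n"
    using assms by (induction n) (auto simp: character_on_def)
  then show ?thesis by simp
qed

lemma character_on_int_pow:
  assumes "subgroup H G" "character_on H \<chi>" "x \<in> H"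
  shows "\<chi> (x [^] (n::int)) = \<chi> x powi n"
proof -
  interpret H: subgroup H G by fact
  have "x [^] m \<in> H" for m :: nat
    using subgroup_int_pow_closed[OF assms(1,3), of "int m"] by (simp add: int_pow_int)
  then have "\<chi> (inv (x [^] m)) = inverse (\<chi> x ^ m)" for m :: nat
    using character_on_inv[OF assms(1,2)] character_on_nat_pow[OF assms] by metis
  then show ?thesis
    unfolding int_pow_def2 power_int_def power_inverse
    using character_on_nat_pow[OF assms] by (metis not_less)
qed

text \<open>Nonzero values and the value 1 at the unit imply each other: \<open>e \<one>\<close> is
  a nonzero idempotent in one direction, and \<open>e x\<close> has the inverse
  \<open>e (inv x)\<close> in the other.\<close>

lemma dual_group_iff:
  "e \<in> carrier (dual_group G) \<longleftrightarrow> character_on (carrier G) e \<and> e \<in> extensional (carrier G)"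
proof -
  have "e x \<noteq> 0" if "character_on (carrier G) e" "x \<in> carrier G" for x
    using that by (metis character_on_def inv_closed mult_zero_left r_inv zero_neq_one)
  moreover have "e \<one> = 1" if "e \<in> hom G (units_of complex_ring)"
  proof -
    have "e \<one> * e \<one> = e \<one>" "e \<one> \<noteq> 0"
      using that hom_mult[OF that, of \<one> \<one>] hom_in_carrier[OF that, of \<one>]
      by (auto simp: carrier_units_complex mult_units_complex)
    then show ?thesis by simp
  qed
  ultimately show ?thesis
    by (auto simp: dual_group_def hom_def carrier_units_complex mult_units_complex character_on_def)
qed

text \<open>
  With \<open>k\<close> minimal such that \<open>g\<^sup>k \<in> H\<close>, the value at \<open>g\<close> can be any \<open>k\<close>-th root of \<open>\<chi>(g\<^sup>k)\<close>;
  there are \<open>k \<ge> 2\<close> of them.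
\<close>

lemma character_extend_step:
  assumes fin: "finite (carrier G)" and H: "subgroup H G" and \<chi>: "character_on H \<chi>"
    and g: "g \<in> carrier G" "g \<notin> H"
  obtains H' \<chi>' where "subgroup H' G" "H \<subseteq> H'" "g \<in> H'" "character_on H' \<chi>'"
    "\<And>x. x \<in> H \<Longrightarrow> \<chi>' x = \<chi> x" "\<chi>' g \<noteq> 1"
proof -
  interpret H: subgroup H G by fact
  define k where "k = (LEAST k::nat. k > 0 \<and> g [^] k \<in> H)"
  \<comment> \<open>The group order is an exponent that makes the \<open>LEAST\<close>
    meaningful.\<close>
  have "Coset.order G > 0 \<and> g [^] Coset.order G \<in> H"
    using pow_order_eq_1[OF g(1)] fin order_gt_0_iff_finite by simp
  then have k: "k > 0" "g [^] k \<in> H"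
    unfolding k_def by (metis (mono_tags, lifting) LeastI)+
  have k_min: "\<not> (0 < j \<and> g [^] j \<in> H)" if "j < k" for j :: nat
    using not_less_Least that unfolding k_def by blast
  have "k \<noteq> 1" using k g by auto
  have "\<chi> (g [^] k) * \<chi> (inv (g [^] k)) = 1"
    using \<chi> k H.m_inv_closed[OF k(2)] r_inv g(1) by (metis character_on_def nat_pow_closed)
  then have "\<chi> (g [^] k) \<noteq> 0" by auto
  then have card: "card {w. w ^ k = \<chi> (g [^] k)} = k"
    using k by (intro card_nth_roots)
  \<comment> \<open>As \<open>k\<close> exceeds 1, the \<open>k\<close> distinct roots cannot all
    equal 1; this secures a value other than 1 at \<open>g\<close>.\<close>
  have "\<not> {w. w ^ k = \<chi> (g [^] k)} \<subseteq> {1}"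
  proof
    assume "{w. w ^ k = \<chi> (g [^] k)} \<subseteq> {1}"
    from card_mono[OF _ this] show False using card k \<open>k \<noteq> 1\<close> by simp
  qed
  then obtain w where w: "w ^ k = \<chi> (g [^] k)" "w \<noteq> 1" by blast
  then have "w \<noteq> 0" using \<open>\<chi> (g [^] k) \<noteq> 0\<close> k by (auto simp: power_0_left)
  \<comment> \<open>Consistency of \<open>w\<close> with \<open>\<chi>\<close>: by minimality of
    \<open>k\<close>, every power of \<open>g\<close> in \<open>H\<close> has an exponent divisible
    by \<open>k\<close>.\<close>
  have pow_mem: "\<chi> (g [^] n) = w powi n" if n: "g [^] n \<in> H" for n :: int
  proof -
    define q r where "q = n div int k" and "r = n mod int k"
    have n_eq: "n = int k * q + r" and r: "0 \<le> r" "r < int k"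
      using k by (simp_all add: q_def r_def)
    have 1: "g [^] (int k * q) = (g [^] k) [^] q"
      using g by (metis int_pow_pow int_pow_int)
    have "g [^] (int k * q) \<in> H"
      unfolding 1 using k(2) H by (simp add: subgroup_int_pow_closed)
    moreover have "g [^] r = g [^] n \<otimes> inv (g [^] (int k * q))"
      using int_pow_diff[OF g(1), of n "int k * q"] by (simp add: n_eq)
    ultimately have "g [^] r \<in> H" using n by simp
    then have "g [^] nat r \<in> H"
      using r by (simp add: pow_nat)
    then have "r = 0"
      using k_min[of "nat r"] r by linarith
    then have "\<chi> (g [^] n) = \<chi> (g [^] k) powi q"
      using character_on_int_pow[OF H \<chi> k(2), of q] 1 n_eq by simp
    also have "\<dots> = w powi n"
      using \<open>r = 0\<close> n_eq w(1) by (simp add: power_int_mult)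
    finally show ?thesis .
  qed
  define H' where "H' = H <#> generate G {g}"
  have H'_iff: "x \<in> H' \<longleftrightarrow> (\<exists>h\<in>H. \<exists>i::int. x = h \<otimes> g [^] i)" for x
    by (auto simp: H'_def set_mult_def generate_pow[OF g(1)])
  have H': "subgroup H' G"
    unfolding H'_def using g by (intro mult_subgroups H generate_is_subgroup) auto
  define \<chi>' where "\<chi>' x = (THE v. \<exists>h\<in>H. \<exists>i::int. x = h \<otimes> g [^] i \<and> v = \<chi> h * w powi i)" for x
  have \<chi>'_eq: "\<chi>' (h \<otimes> g [^] i) = \<chi> h * w powi i" if h: "h \<in> H" for h and i :: int
    unfolding \<chi>'_def
  proof (rule the_equality)
    fix v assume "\<exists>h'\<in>H. \<exists>j::int. h \<otimes> g [^] i = h' \<otimes> g [^] j \<and> v = \<chi> h' * w powi j"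
    then obtain h' and j :: int where h': "h' \<in> H" "h \<otimes> g [^] i = h' \<otimes> g [^] j" "v = \<chi> h' * w powi j"
      by blast
    \<comment> \<open>Two representations of one element differ by a power of \<open>g\<close> that
      lies in \<open>H\<close>, where \<open>pow_mem\<close> applies.\<close>
    have "g [^] (j - i) = inv h' \<otimes> h"
    proof -
      have "h' \<otimes> g [^] (j - i) = h"
        using h' h g H.mem_carrier by (simp add: int_pow_diff m_assoc[symmetric]) (simp add: h'(2)[symmetric] m_assoc)
      then show ?thesis using h' h g H.mem_carrier by (metis inv_solve_left int_pow_closed)
    qed
    moreover have "h' \<otimes> (inv h' \<otimes> h) = h"
      using h h' H.mem_carrier by (simp add: m_assoc[symmetric])
    ultimately have mem: "g [^] (j - i) \<in> H" and h_eq: "h = h' \<otimes> g [^] (j - i)"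
      using h h' by auto
    then have "\<chi> h = \<chi> h' * w powi (j - i)"
      using \<chi> h'(1) pow_mem[OF mem] by (metis character_on_def)
    then show "v = \<chi> h * w powi i"
      using h'(3) \<open>w \<noteq> 0\<close> by (simp add: power_int_add[symmetric] mult.assoc)
  qed (use h in blast)
  show ?thesis
  proof (rule that[OF H'])
    show ext: "\<chi>' x = \<chi> x" if "x \<in> H" for x
      using \<chi>'_eq[OF that, of 0] that H.mem_carrier by simp
    show "H \<subseteq> H'"
    proof
      fix x assume x: "x \<in> H"
      then have "x = x \<otimes> g [^] (0::int)" using H.mem_carrier by (metis int_pow_0 r_one)
      then show "x \<in> H'" using x H'_iff by blast
    qed
    show "g \<in> H'"
      using H'_iff[of g] H.one_closed l_one[OF g(1)] int_pow_1[OF g(1)] by metis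
    show "\<chi>' g \<noteq> 1"
    proof -
      have "\<chi>' (\<one> \<otimes> g [^] (1::int)) = \<chi> \<one> * w powi 1"
        by (rule \<chi>'_eq) (rule H.one_closed)
      also have "\<chi> \<one> = 1" using \<chi> by (simp add: character_on_def)
      finally show ?thesis using w(2) g(1) by simp
    qed
    show "character_on H' \<chi>'"
      unfolding character_on_def
    proof (intro conjI ballI)
      show "\<chi>' \<one> = 1" using ext[of \<one>] \<chi> by (simp add: character_on_def)
      fix x y assume "x \<in> H'" "y \<in> H'"
      then obtain h h' and i j :: int where
        hh: "h \<in> H" "h' \<in> H" and xy: "x = h \<otimes> g [^] i" "y = h' \<otimes> g [^] j"
        unfolding H'_iff by blast
      then have "x \<otimes> y = (h \<otimes> h') \<otimes> g [^] (i + j)"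
        using g H.mem_carrier by (simp add: int_pow_mult m_ac)
      then show "\<chi>' (x \<otimes> y) = \<chi>' x * \<chi>' y"
        using hh xy \<chi> \<open>w \<noteq> 0\<close> \<chi>'_eq by (simp add: character_on_def power_int_add)
    qed
  qed
qed

text \<open>Adjoin elements outside \<open>H\<close> one at a time; finiteness stops the process at
  the whole group.\<close>

lemma character_extend:
  assumes "finite (carrier G)" "subgroup H G" "character_on H \<chi>"
  shows "\<exists>e. character_on (carrier G) e \<and> (\<forall>x\<in>H. e x = \<chi> x)"
  using assms(2,3)
proof (induction "card (carrier G) - card H" arbitrary: H \<chi> rule: less_induct)
  case less
  show ?case
  proof (cases "H = carrier G")
    case True
    then show ?thesis using less.prems by blast
  next
    case False
    then obtain g where g: "g \<in> carrier G" "g \<notin> H"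
      using subgroup.subset[OF less.prems(1)] by blast
    obtain H' \<chi>' where H': "subgroup H' G" "H \<subseteq> H'" "g \<in> H'" "character_on H' \<chi>'"
      "\<And>x. x \<in> H \<Longrightarrow> \<chi>' x = \<chi> x"
      using character_extend_step[OF assms(1) less.prems g] by metis
    have "card H < card H'" "card H' \<le> card (carrier G)"
      using H' g assms(1) subgroup.subset[OF H'(1)]
      by (auto intro!: psubset_card_mono card_mono intro: finite_subset)
    then have "card (carrier G) - card H' < card (carrier G) - card H" by linarith
    from less.hyps[OF this H'(1,4)]
    obtain e where "character_on (carrier G) e" "\<forall>x\<in>H'. e x = \<chi>' x" by blast
    then show ?thesis using H'(2,5) by (metis subsetD)
  qed
qed

text \<open>From the trivial character of the trivial subgroup, one extension step can avoid the
  value 1 at \<open>z\<close>; extending further to \<open>G\<close> keeps that value.\<close>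

lemma dual_group_separates:
  assumes "finite (carrier G)" "z \<in> carrier G" "z \<noteq> \<one>"
  obtains e where "e \<in> carrier (dual_group G)" "e z \<noteq> 1"
proof -
  have triv: "character_on {\<one>} (\<lambda>_. 1)" by (simp add: character_on_def)
  obtain H \<chi> where "subgroup H G" "z \<in> H" "character_on H \<chi>" "\<chi> z \<noteq> 1"
    using character_extend_step[OF assms(1) triv_subgroup triv assms(2)] assms(3)
    by (metis singletonD)
  then obtain e where "character_on (carrier G) e" "e z \<noteq> 1"
    using character_extend[OF assms(1)] by metis
  then show ?thesis
    using assms(2) by (intro that[of "restrict e (carrier G)"]) (auto simp: dual_group_iff character_on_def)
qed

section \<open>Pointwise operations and values in the dual group\<close>

lemma dual_group_mult: "x \<in> carrier G \<Longrightarrow> (d \<otimes>\<^bsub>dual_group G\<^esub> e) x = d x * e x"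
  by (simp add: dual_group_def)

lemma dual_group_one: "x \<in> carrier G \<Longrightarrow> \<one>\<^bsub>dual_group G\<^esub> x = 1"
  by (simp add: dual_group_def)

lemma dual_group_nat_pow:
  "x \<in> carrier G \<Longrightarrow> (e [^]\<^bsub>dual_group G\<^esub> (n::nat)) x = e x ^ n"
  by (induction n) (simp_all add: dual_group_mult dual_group_one)

lemma dual_group_inv:
  assumes "e \<in> carrier (dual_group G)" "x \<in> carrier G"
  shows "(inv\<^bsub>dual_group G\<^esub> e) x = inverse (e x)"
proof -
  interpret D: comm_group "dual_group G" by (rule comm_group_dual) (rule comm_group_axioms)
  have "e x * (inv\<^bsub>dual_group G\<^esub> e) x = (e \<otimes>\<^bsub>dual_group G\<^esub> inv\<^bsub>dual_group G\<^esub> e) x"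
    using assms(2) by (simp add: dual_group_mult)
  also have "\<dots> = \<one>\<^bsub>dual_group G\<^esub> x" using assms(1) by simp
  also have "\<dots> = 1" using assms(2) by (rule dual_group_one)
  finally show ?thesis by (metis inverse_unique)
qed

lemma dual_group_int_pow:
  assumes "e \<in> carrier (dual_group G)" "x \<in> carrier G"
  shows "(e [^]\<^bsub>dual_group G\<^esub> (n::int)) x = e x powi n"
proof -
  interpret D: comm_group "dual_group G" by (rule comm_group_dual) (rule comm_group_axioms)
  show ?thesis
  proof (cases "n < 0")
    case True
    then have "(e [^]\<^bsub>dual_group G\<^esub> n) x = (inv\<^bsub>dual_group G\<^esub> (e [^]\<^bsub>dual_group G\<^esub> nat (- n))) x"
      by (simp only: int_pow_def2 if_True)
    also have "\<dots> = inverse (e x ^ nat (- n))"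
      using assms by (simp only: dual_group_inv dual_group_nat_pow D.nat_pow_closed)
    finally show ?thesis using True by (simp add: power_int_def power_inverse)
  next
    case False
    then have "(e [^]\<^bsub>dual_group G\<^esub> n) x = (e [^]\<^bsub>dual_group G\<^esub> nat n) x"
      by (simp only: int_pow_def2 if_False)
    also have "\<dots> = e x ^ nat n"
      using assms(2) by (rule dual_group_nat_pow)
    finally show ?thesis using False by (simp add: power_int_def)
  qed
qed

lemma dual_group_value_root_of_unity:
  assumes "e \<in> carrier (dual_group G)" "x \<in> carrier G" "group.ord (dual_group G) e dvd n"
  shows "e x ^ n = 1"
proof -
  interpret D: comm_group "dual_group G" by (rule comm_group_dual) (rule comm_group_axioms)
  have "e [^]\<^bsub>dual_group G\<^esub> n = \<one>\<^bsub>dual_group G\<^esub>"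
    using D.pow_eq_id[OF assms(1)] assms(3) by simp
  then show ?thesis
    using dual_group_nat_pow[OF assms(2), of e n] assms(2) by (simp add: dual_group_one)
qed

text \<open>All values are roots of unity of exponent the order of \<open>G\<close>, so the
  extensional characters lie in a finite function space.\<close>

lemma finite_dual_group:
  assumes "finite (carrier G)"
  shows "finite (carrier (dual_group G))"
proof (rule finite_subset)
  let ?U = "{z::complex. z ^ Coset.order G = 1}"
  have "Coset.order G > 0" using assms order_gt_0_iff_finite by simp
  then show "finite (carrier G \<rightarrow>\<^sub>E ?U)"
    using assms by (intro finite_PiE) auto
  show "carrier (dual_group G) \<subseteq> carrier G \<rightarrow>\<^sub>E ?U"
  proof
    fix e assume e: "e \<in> carrier (dual_group G)"
    then have "e x ^ Coset.order G = 1" if "x \<in> carrier G" for x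
      using that character_on_nat_pow[OF subgroup_self, of e x "Coset.order G"] pow_order_eq_1[OF that]
      by (simp add: dual_group_iff character_on_def)
    then show "e \<in> carrier G \<rightarrow>\<^sub>E ?U" using e by (auto simp: dual_group_iff PiE_def)
  qed
qed

section \<open>Orthogonality and Fourier inversion\<close>

text \<open>Translation by a character \<open>d\<close> with \<open>d z \<noteq> 1\<close> permutes
  the terms of the sum but multiplies it by \<open>d z\<close>, so the sum vanishes.\<close>

lemma sum_dual_group:
  assumes "finite (carrier G)" "z \<in> carrier G"
  shows "(\<Sum>e\<in>carrier (dual_group G). e z) = (if z = \<one> then of_nat (Coset.order (dual_group G)) else 0)"
proof (cases "z = \<one>")
  case True
  then show ?thesis by (simp add: dual_group_iff character_on_def Coset.order_def)
next
  case False
  interpret D: comm_group "dual_group G" by (rule comm_group_dual) (rule comm_group_axioms)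
  let ?S = "\<Sum>e\<in>carrier (dual_group G). e z"
  obtain d where d: "d \<in> carrier (dual_group G)" "d z \<noteq> 1"
    using dual_group_separates[OF assms False] by blast
  have "?S = (\<Sum>e\<in>carrier (dual_group G). (d \<otimes>\<^bsub>dual_group G\<^esub> e) z)"
    by (rule sum.reindex_bij_betw[symmetric])
      (use D.surj_const_mult D.inj_on_cmult d(1) in \<open>auto simp: bij_betw_def\<close>)
  also have "\<dots> = d z * ?S"
    using assms(2) by (simp add: dual_group_mult sum_distrib_left)
  finally have "(1 - d z) * ?S = 0" by (simp add: algebra_simps)
  then show ?thesis using d(2) False by simp
qed

text \<open>Finite order puts the values on the unit circle, where conjugation is inversion.\<close>

lemma dual_group_cnj:
  assumes "finite (carrier G)" "e \<in> carrier (dual_group G)" "x \<in> carrier G"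
  shows "cnj (e x) = inverse (e x)"
proof -
  interpret D: comm_group "dual_group G" by (rule comm_group_dual) (rule comm_group_axioms)
  have "D.ord e \<ge> 1"
    using D.ord_ge_1 finite_dual_group assms by blast
  then have "norm (e x) = 1"
    using dual_group_value_root_of_unity[OF assms(2,3) dvd_refl] power_eq_1_iff by fastforce
  then have "e x * cnj (e x) = 1"
    by (simp add: complex_norm_square[symmetric])
  then show ?thesis by (metis inverse_unique)
qed

text \<open>After exchanging the sums, orthogonality at \<open>inv y \<otimes> x\<close> keeps only
  the term \<open>y = x\<close>.\<close>

lemma fourier_inversion:
  assumes "finite (carrier G)" "x \<in> carrier G"
  shows "(\<Sum>e\<in>carrier (dual_group G). fourier G f e * e x) = of_nat (Coset.order (dual_group G)) * f x"
proof -
  let ?D = "carrier (dual_group G)"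
  have *: "cnj (e y) * e x = e (inv y \<otimes> x)" if "e \<in> ?D" "y \<in> carrier G" for e y
  proof -
    have "character_on (carrier G) e" using that dual_group_iff by blast
    then have "e (inv y \<otimes> x) = e (inv y) * e x" "e (inv y) = inverse (e y)"
      using that assms character_on_inv[OF subgroup_self] by (auto simp: character_on_def)
    then show ?thesis using dual_group_cnj[OF assms(1) that] by simp
  qed
  have "(\<Sum>e\<in>?D. fourier G f e * e x) = (\<Sum>e\<in>?D. \<Sum>y\<in>carrier G. f y * e (inv y \<otimes> x))"
    unfolding fourier_def sum_distrib_right by (intro sum.cong refl) (simp add: * mult.assoc)
  also have "\<dots> = (\<Sum>y\<in>carrier G. f y * (\<Sum>e\<in>?D. e (inv y \<otimes> x)))"
    by (subst sum.swap) (simp add: sum_distrib_left)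
  also have "\<dots> = (\<Sum>y\<in>carrier G. if y = x then f y * of_nat (Coset.order (dual_group G)) else 0)"
  proof (rule sum.cong)
    fix y assume y: "y \<in> carrier G"
    then have "inv y \<otimes> x = \<one> \<longleftrightarrow> y = x"
      using assms(2) by (metis inv_closed inv_equality inv_inv l_inv)
    then show "f y * (\<Sum>e\<in>?D. e (inv y \<otimes> x)) = (if y = x then f y * of_nat (Coset.order (dual_group G)) else 0)"
      using y assms by (simp add: sum_dual_group)
  qed simp
  finally show ?thesis using assms by simp
qed

text \<open>Character values are roots of unity of exponent the order of the dual group, so an
  inverse exponent \<open>v\<close> recovers them pointwise from their \<open>u\<close>-th powers.
  By finiteness this injectivity suffices.\<close>

lemma dual_group_pow_bij:
  assumes "finite (carrier G)" "coprime u (Coset.order (dual_group G))"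
  shows "bij_betw (\<lambda>e. e [^]\<^bsub>dual_group G\<^esub> u) (carrier (dual_group G)) (carrier (dual_group G))"
proof -
  interpret D: comm_group "dual_group G" by (rule comm_group_dual) (rule comm_group_axioms)
  let ?D = "carrier (dual_group G)"
  have "Coset.order (dual_group G) > 0"
    using finite_dual_group[OF assms(1)] D.order_gt_0_iff_finite by simp
  then obtain v where v: "\<And>z::complex. z ^ Coset.order (dual_group G) = 1 \<Longrightarrow> (z ^ u) ^ v = z"
    using coprime_power_cancel assms(2) by metis
  have "inj_on (\<lambda>e. e [^]\<^bsub>dual_group G\<^esub> u) ?D"
  proof (rule inj_onI)
    fix d e assume de: "d \<in> ?D" "e \<in> ?D" "d [^]\<^bsub>dual_group G\<^esub> u = e [^]\<^bsub>dual_group G\<^esub> u"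
    have "d x = e x" if "x \<in> carrier G" for x
      using de(1,2) v dual_group_nat_pow[OF that] de(3) D.ord_dvd_group_order dual_group_value_root_of_unity that
      by metis
    then show "d = e"
      using de(1,2) by (auto simp: dual_group_iff intro: extensionalityI)
  qed
  then show ?thesis
    unfolding bij_betw_def using finite_dual_group[OF assms(1)]
    by (intro conjI endo_inj_surj) auto
qed

section \<open>The two implications\<close>

lemma fourier_mem_adjoin:
  assumes fin: "finite (carrier G)" and K: "complex_subfield K"
    and f: "\<And>x. x \<in> carrier G \<Longrightarrow> f x \<in> K" and e: "e \<in> carrier (dual_group G)"
  shows "fourier G f e \<in> adjoin K (zeta (group.ord (dual_group G) e))"
proof -
  interpret D: comm_group "dual_group G" by (rule comm_group_dual) (rule comm_group_axioms)
  interpret K: complex_subfield K by fact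
  interpret L: complex_subfield "adjoin K (zeta (D.ord e))" by (rule complex_subfield_adjoin)
  have "D.ord e > 0"
    using D.ord_ge_1[OF finite_dual_group[OF fin] e] by simp
  then have "cnj (e x) \<in> adjoin K (zeta (D.ord e))" if "x \<in> carrier G" for x
    using dual_group_value_root_of_unity[OF e that dvd_refl] dual_group_cnj[OF fin e that]
      root_of_unity_mem_adjoin L.inverse_mem by metis
  then show ?thesis
    unfolding fourier_def using f K.subset_adjoin by (blast intro: L.sum_mem L.mult_mem)
qed

lemma sigma_fourier:
  assumes fin: "finite (carrier G)" and K: "complex_subfield K"
    and f: "\<And>x. x \<in> carrier G \<Longrightarrow> f x \<in> K" and e: "e \<in> carrier (dual_group G)"
    and \<sigma>: "\<sigma> \<in> Gal (adjoin K (zeta (group.ord (dual_group G) e))) K"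
      "is_sigma (group.ord (dual_group G) e) u \<sigma>"
  shows "\<sigma> (fourier G f e) = fourier G f (e [^]\<^bsub>dual_group G\<^esub> u)"
proof -
  interpret D: comm_group "dual_group G" by (rule comm_group_dual) (rule comm_group_axioms)
  interpret K: complex_subfield K by fact
  define M where "M = D.ord e"
  have "M > 0"
    using D.ord_ge_1[OF finite_dual_group[OF fin] e] by (simp add: M_def)
  interpret relative_hom K "adjoin K (zeta M)" \<sigma>
    using \<sigma>(1) by (intro Gal_relative_hom K complex_subfield_adjoin K.subset_adjoin) (simp add: M_def)
  have root: "cnj (e x) ^ M = 1" if "x \<in> carrier G" for x
    using dual_group_value_root_of_unity[OF e that dvd_refl]
    by (metis M_def complex_cnj_one complex_cnj_power)
  have mem: "f x \<in> adjoin K (zeta M)" "cnj (e x) \<in> adjoin K (zeta M)" if "x \<in> carrier G" for x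
    using root_of_unity_mem_adjoin[OF \<open>M > 0\<close> root[OF that]] f[OF that] K.subset_adjoin by auto
  have val: "\<sigma> (cnj (e x)) = cnj ((e [^]\<^bsub>dual_group G\<^esub> u) x)" if x: "x \<in> carrier G" for x
  proof -
    have "\<sigma> (cnj (e x)) = cnj (e x) powi u"
      using \<sigma>(2) root[OF x] by (simp add: is_sigma_def M_def)
    also have "\<dots> = cnj (e x powi u)"
      by (simp add: power_int_def)
    finally show ?thesis using dual_group_int_pow[OF e x] by simp
  qed
  have "\<sigma> (fourier G f e) = (\<Sum>x\<in>carrier G. \<sigma> (f x * cnj (e x)))"
    unfolding fourier_def using mem by (intro hom_sum) (simp add: L.mult_mem)
  also have "\<dots> = fourier G f (e [^]\<^bsub>dual_group G\<^esub> u)"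
    unfolding fourier_def using mem f by (intro sum.cong refl) (simp add: hom_mult fixed val)
  finally show ?thesis .
qed

lemma galois_equivariant_imp_mem:
  assumes fin: "finite (carrier G)" and K: "complex_subfield K"
    and mem: "\<And>e. e \<in> carrier (dual_group G) \<Longrightarrow>
      fourier G f e \<in> adjoin K (zeta (group.ord (dual_group G) e))"
    and equiv: "\<And>e \<sigma> u. e \<in> carrier (dual_group G) \<Longrightarrow>
      \<sigma> \<in> Gal (adjoin K (zeta (group.ord (dual_group G) e))) K \<Longrightarrow>
      is_sigma (group.ord (dual_group G) e) u \<sigma> \<Longrightarrow>
      \<sigma> (fourier G f e) = fourier G f (e [^]\<^bsub>dual_group G\<^esub> u)"
    and x: "x \<in> carrier G"
  shows "f x \<in> K"
proof -
  interpret D: comm_group "dual_group G" by (rule comm_group_dual) (rule comm_group_axioms)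
  interpret K: complex_subfield K by fact
  let ?D = "carrier (dual_group G)"
  define N where "N = Coset.order (dual_group G)"
  have N: "N > 0"
    using finite_dual_group[OF fin] D.order_gt_0_iff_finite by (simp add: N_def)
  let ?L = "adjoin K (zeta N)"
  interpret L: complex_subfield ?L by (rule complex_subfield_adjoin)
  have ord: "D.ord e dvd N" if "e \<in> ?D" for e
    using D.ord_dvd_group_order[OF that] by (simp add: N_def)
  have sub: "adjoin K (zeta M) \<subseteq> ?L" if "M dvd N" for M
  proof (rule K.adjoin_subset)
    show "zeta M \<in> ?L"
      using zeta_dvd_power[OF that N] mem_adjoin L.power_mem by metis
  qed (rule K.subset_adjoin, rule complex_subfield_adjoin)
  have fourier_mem: "fourier G f e \<in> ?L" if "e \<in> ?D" for e
    using mem[OF that] sub[OF ord[OF that]] by blast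
  have value_root: "e x ^ N = 1" if "e \<in> ?D" for e
    using dual_group_value_root_of_unity[OF that x ord[OF that]] .
  have value_mem: "e x \<in> ?L" if "e \<in> ?D" for e
    using root_of_unity_mem_adjoin[OF N value_root[OF that]] .
  have f_eq: "f x = (\<Sum>e\<in>?D. fourier G f e * e x) / of_nat N"
    using fourier_inversion[OF fin x, of f] N by (simp add: N_def)
  have f_mem: "f x \<in> ?L"
    unfolding f_eq using fourier_mem value_mem by (intro L.divide_mem L.sum_mem L.mult_mem L.of_nat_mem)
  show ?thesis
  proof (rule K.fixed_by_conjugates_imp_mem[OF N f_mem])
    fix \<tau> assume \<tau>: "relative_hom K ?L \<tau>"
    interpret relative_hom K ?L \<tau> by fact
    obtain u where u: "coprime u N" "\<tau> (zeta N) = zeta N ^ u"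
      using zeta_conjugate[OF K N \<tau>] by blast
    have root: "\<tau> z = z ^ u" if z: "z ^ N = 1" for z
    proof -
      obtain k where "z = zeta N ^ k" using root_of_unity_zeta_power[OF N z] by blast
      then show ?thesis
        by (simp add: hom_power mem_adjoin u(2) power_mult[symmetric] mult.commute)
    qed
    \<comment> \<open>\<open>v\<close> inverts \<open>u\<close> modulo \<open>N\<close>, hence
      modulo every divisor \<open>M\<close>; it supplies \<open>zeta M ^ v\<close> as a preimage of
      \<open>zeta M\<close> below.\<close>
    obtain v where v: "\<And>z::complex. z ^ N = 1 \<Longrightarrow> (z ^ u) ^ v = z"
      using coprime_power_cancel[OF N u(1)] by blast
    have \<tau>_fourier: "\<tau> (fourier G f e) = fourier G f (e [^]\<^bsub>dual_group G\<^esub> u)" if e: "e \<in> ?D" for e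
    proof -
      define M where "M = D.ord e"
      have M: "M dvd N" using ord[OF e] by (simp add: M_def)
      then have "M > 0" using N by (metis dvd_pos_nat)
      have rootM: "z ^ N = 1" if "z ^ M = 1" for z :: complex
        using M that by (metis dvdE power_mult power_one)
      have "zeta M ^ N = 1"
        using rootM zeta_power_self[OF \<open>M > 0\<close>] by blast
      interpret F: complex_subfield "adjoin K (zeta M)" by (rule complex_subfield_adjoin)
      \<comment> \<open>Equivariance is assumed only for automorphisms of
        \<open>adjoin K (zeta M)\<close>, so \<open>\<tau>\<close> is first cut down to one of
        these.\<close>
      interpret M: relative_hom K "adjoin K (zeta M)" \<tau>
        by (rule relative_hom_mono[OF complex_subfield_adjoin K.subset_adjoin sub[OF M]])
      let ?\<sigma> = "restrict \<tau> (adjoin K (zeta M))"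
      have "\<tau> (zeta M ^ v) = zeta M"
        using root[OF \<open>zeta M ^ N = 1\<close>] v[OF \<open>zeta M ^ N = 1\<close>] by (simp add: M.hom_power mem_adjoin)
      then have "zeta M \<in> \<tau> ` adjoin K (zeta M)"
        using mem_adjoin F.power_mem by (metis imageI)
      moreover have "\<tau> (zeta M) \<in> adjoin K (zeta M)"
        using root[OF \<open>zeta M ^ N = 1\<close>] mem_adjoin F.power_mem by metis
      ultimately have "?\<sigma> \<in> Gal (adjoin K (zeta M)) K"
        by (intro relative_hom_restrict_Gal M.relative_hom_axioms)
      moreover have "is_sigma M (int u) ?\<sigma>"
        unfolding is_sigma_def
      proof (intro conjI allI impI)
        show "coprime (int u) (int M)"
          using u(1) M by (metis coprime_divisors coprime_int_iff dvd_refl)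
        show "?\<sigma> z = z powi int u" if "z ^ M = 1" for z
          using root[OF rootM[OF that]] root_of_unity_mem_adjoin[OF \<open>M > 0\<close> that] by simp
      qed
      ultimately have "?\<sigma> (fourier G f e) = fourier G f (e [^]\<^bsub>dual_group G\<^esub> int u)"
        using equiv[OF e] by (simp add: M_def)
      then show ?thesis
        using mem[OF e] by (simp add: M_def int_pow_int)
    qed
    have \<tau>_value: "\<tau> (e x) = (e [^]\<^bsub>dual_group G\<^esub> u) x" if "e \<in> ?D" for e
      using root[OF value_root[OF that]] dual_group_nat_pow[OF x] by simp
    \<comment> \<open>Clearing the denominator lets \<open>\<tau>\<close> act on the inversion sum
      alone.\<close>
    have "of_nat N * \<tau> (f x) = \<tau> (of_nat N * f x)"
      using K.of_nat_mem K_subset_L f_mem by (simp add: hom_mult fixed subset_iff)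
    also have "of_nat N * f x = (\<Sum>e\<in>?D. fourier G f e * e x)"
      using f_eq N by simp
    also have "\<tau> \<dots> = (\<Sum>e\<in>?D. \<tau> (fourier G f e * e x))"
      using fourier_mem value_mem by (intro hom_sum L.mult_mem)
    also have "\<dots> = (\<Sum>e\<in>?D. fourier G f (e [^]\<^bsub>dual_group G\<^esub> u) * (e [^]\<^bsub>dual_group G\<^esub> u) x)"
      using fourier_mem value_mem by (intro sum.cong refl) (simp add: hom_mult \<tau>_fourier \<tau>_value)
    \<comment> \<open>Raising to the power \<open>u\<close> permutes the characters, so the sum is
      only reordered.\<close>
    also have "\<dots> = (\<Sum>e\<in>?D. fourier G f e * e x)"
      using dual_group_pow_bij[OF fin] u(1) by (intro sum.reindex_bij_betw) (simp add: N_def)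
    also have "\<dots> = of_nat N * f x"
      using f_eq N by simp
    finally show "\<tau> (f x) = f x" using N by simp
  qed
qed

end

theorem theorem1p5:
  fixes G :: "('a, 'b) monoid_scheme" and f :: "'a \<Rightarrow> complex" and K :: "complex set"
  assumes "comm_group G" and "finite (carrier G)" and "subfield K complex_ring"
  shows "(\<forall>x\<in>carrier G. f x \<in> K) \<longleftrightarrow>
    (\<forall>e\<in>carrier (dual_group G).
      let M = group.ord (dual_group G) e; L = adjoin K (zeta M)
      in fourier G f e \<in> L \<and>
        (\<forall>\<sigma>\<in>Gal L K. \<forall>u::int. is_sigma M u \<sigma> \<longrightarrow>
          \<sigma> (fourier G f e) = fourier G f (e [^]\<^bsub>dual_group G\<^esub> u)))"
proof -
  interpret comm_group G by fact
  have K: "complex_subfield K" using assms(3) by (rule complex_subfield.intro)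
  show ?thesis (is "?lhs \<longleftrightarrow> ?rhs")
  proof
    show "?lhs \<Longrightarrow> ?rhs"
      using fourier_mem_adjoin[OF assms(2) K] sigma_fourier[OF assms(2) K] by (simp add: Let_def)
    show "?rhs \<Longrightarrow> ?lhs"
      using galois_equivariant_imp_mem[OF assms(2) K] by (simp add: Let_def)
  qed
qed

end
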